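(* In a full relational model over a set of states $\Sigma$ (states being valuations of program variables), the following inference rules for backward simulation judgments $c\mid d:P\overset{\exists\leftarrow}{\approx>}Q$ are sound, i.e., whenever the premises hold the conclusion holds (all $P,Q,R,S$ relations on $\Sigma$, $c,c',d,d'$ relations on $\Sigma$, $e,e'\subseteq\Sigma$ conditions): (bIf) if $c\mid c':P\wedge\langle e]\wedge[e'\rangle\overset{\exists\leftarrow}{\approx>}Q$ and $d\mid d':P\wedge\neg\langle e]\wedge\neg[e'\rangle\overset{\exists\leftarrow}{\approx>}Q$, then $\mathsf{if}\ e\ \mathsf{then}\ c\ \mathsf{else}\ d\mid\mathsf{if}\ e'\ \mathsf{then}\ c'\ \mathsf{else}\ d':P\overset{\exists\leftarrow}{\approx>}Q$; (bWh) if $c\mid c':P\wedge\langle e]\wedge[e'\rangle\overset{\exists\leftarrow}{\approx>}P$, then $\mathsf{while}\ e\ \mathsf{do}\ c\mid\mathsf{while}\ e'\ \mathsf{do}\ c':P\overset{\exists\leftarrow}{\approx>}P\wedge\neg\langle e]\wedge\neg[e'\rangle$; (bSeq) if $c\mid c':P\overset{\exists\leftarrow}{\approx>}R$ and $d\mid d':R\overset{\exists\leftarrow}{\approx>}Q$, then $c;d\mid c';d':P\overset{\exists\leftarrow}{\approx>}Q$; (bnAss) for program variables $x,y$, if $1\le[y:=\mathrm{any}\rangle;\dot R;[y:=\mathrm{any}\rangle$ then $x:=\mathrm{any}\mid y:=\mathrm{any}:R\overset{\exists\leftarrow}{\approx>}\mathit{true}$; (bConseq) if $R\subseteq P$, $c\mid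 d:R\overset{\exists\leftarrow}{\approx>}S$ and $Q\subseteq S$, then $c\mid d:P\overset{\exists\leftarrow}{\approx>}Q$; (bDisj) if $c\mid d:P\overset{\exists\leftarrow}{\approx>}Q$ and $c\mid d:P\overset{\exists\leftarrow}{\approx>}R$ then $c\mid d:P\overset{\exists\leftarrow}{\approx>}Q\vee R$.
   Context: $\Sigma$ is the set of states (functions from program variables to values). The full relational model has as actions all relations on $\Sigma$ and as tests all sub-identities; the full relational BiKAT has all relations on $\Sigma\times\Sigma$ and all sub-identities of $\Sigma\times\Sigma$ as bitests; $1$ is the identity, $;$ composition, $\le$ inclusion. The backward simulation judgment $c\mid d:P\overset{\exists\leftarrow}{\approx>}Q$ means $\forall\sigma,\tau,\tau'.\ \sigma\,c\,\tau\wedge\tau Q\tau'\Rightarrow\exists\sigma'.\ \sigma P\sigma'\wedge\sigma'\,d\,\tau'$. A condition $e\subseteq\Sigma$ is identified with the sub-identity $\{(\sigma,\sigma):\sigma\in e\}$; $\mathsf{if}\ e\ \mathsf{then}\ c\ \mathsf{else}\ d=e;c\cup\neg e;d$, $\mathsf{while}\ e\ \mathsf{do}\ c=(e;c)^*;\neg e$. $P\wedge\langle e]=\{(\sigma,\sigma')\in P:\sigma\in e\}$, $P\wedge[e'\rangle=\{(\sigma,\sigma')\in P:\sigma'\in e'\}$, negated versions use $\sigma\notin e$, $\sigma'\notin e'$; $\vee$ is union; $\mathit{true}=\Sigma\times\Sigma$. $x:=\mathrm{any}$ is the relation $\{(\sigma,\sigma[x\mapsto v])\}$ over all states $\sigma$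 and values $v$. In the BiKAT, $[a\rangle=id_\Sigma\otimes a$ with $(\sigma,\sigma')(R\otimes S)(\tau,\tau')$ iff $\sigma R\tau\wedge\sigma' S\tau'$, and $\dot R$ is the sub-identity containing $((\sigma,\sigma'),(\sigma,\sigma'))$ iff $\sigma R\sigma'$. *)

theory Defs
  imports Main
begin

type_synonym ('var, 'val) state = "'var \<Rightarrow> 'val"

definition bsim :: "'s rel \<Rightarrow> 's rel \<Rightarrow> 's rel \<Rightarrow> 's rel \<Rightarrow> bool" where
  "bsim c d P Q \<longleftrightarrow>
    (\<forall>\<sigma> \<tau> \<tau>'. (\<sigma>, \<tau>) \<in> c \<and> (\<tau>, \<tau>') \<in> Q \<longrightarrow> (\<exists>\<sigma>'. (\<sigma>, \<sigma>') \<in> P \<and> (\<sigma>', \<tau>') \<in> d))"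

definition if_rel :: "'s set \<Rightarrow> 's rel \<Rightarrow> 's rel \<Rightarrow> 's rel" where
  "if_rel e c d = Id_on e O c \<union> Id_on (- e) O d"

definition while_rel :: "'s set \<Rightarrow> 's rel \<Rightarrow> 's rel" where
  "while_rel e c = (Id_on e O c)\<^sup>* O Id_on (- e)"

definition left_cond :: "'s set \<Rightarrow> 's rel" where
  "left_cond e = {(\<sigma>, \<sigma>'). \<sigma> \<in> e}"

definition right_cond :: "'s set \<Rightarrow> 's rel" where
  "right_cond e = {(\<sigma>, \<sigma>'). \<sigma>' \<in> e}"

definition assign_any :: "'var \<Rightarrow> ('var, 'val) state rel" where
  "assign_any x = {(\<sigma>, \<sigma>(x := v)) | \<sigma> v. True}"

definition tensor :: "'s rel \<Rightarrow> 's rel \<Rightarrow> ('s \<times> 's) rel" where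
  "tensor R S = {((\<sigma>, \<sigma>'), (\<tau>, \<tau>')) | \<sigma> \<sigma>' \<tau> \<tau>'. (\<sigma>, \<tau>) \<in> R \<and> (\<sigma>', \<tau>') \<in> S}"

definition right_embed :: "'s rel \<Rightarrow> ('s \<times> 's) rel" where
  "right_embed a = tensor Id a"

text \<open>A relation on states is a set of pairs of states, so its bitest is the sub-identity on that set.\<close>

definition bitest :: "'s rel \<Rightarrow> ('s \<times> 's) rel" where
  "bitest R = Id_on R"

end

theory Submission
  imports Defs
begin

text \<open>
  A backward simulation is the inclusion \<^term>\<open>c O Q \<subseteq> P O d\<close>, so all the structural rules follow
  by algebra of relations; for loops the inclusion for the guarded body is propagated along the
  iterations from the final state back to the initial one. For nondeterministic assignment, the
  premise at the pair \<^term>\<open>(\<sigma>, \<tau>')\<close> of an initial left state and a final right state gives an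
  initial right state related to \<^term>\<open>\<sigma>\<close> from which assigning \<^term>\<open>y\<close> leads to \<^term>\<open>\<tau>'\<close>.
\<close>

lemma bsim_iff_relcomp: "bsim c d P Q \<longleftrightarrow> c O Q \<subseteq> P O d"
  unfolding bsim_def by blast

text \<open>The restricted \<open>P\<close> puts the right witness inside or outside
  \<open>e'\<close>, so the right program takes the same branch as the left.\<close>

lemma bsim_if:
  assumes "bsim c c' (P \<inter> left_cond e \<inter> right_cond e') Q"
    and "bsim d d' (P \<inter> - left_cond e \<inter> - right_cond e') Q"
  shows "bsim (if_rel e c d) (if_rel e' c' d') P Q"
  using assms unfolding bsim_iff_relcomp if_rel_def left_cond_def right_cond_def by fast

text \<open>Moves the guards from the precondition into the commands, so that with
  \<open>Q = P\<close> one iteration preserves \<open>P\<close> in the form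
  \<open>bsim_rtrancl\<close> needs.\<close>

lemma bsim_guarded:
  assumes "bsim c c' (P \<inter> left_cond e \<inter> right_cond e') Q"
  shows "bsim (Id_on e O c) (Id_on e' O c') P Q"
  using assms unfolding bsim_iff_relcomp left_cond_def right_cond_def by fast

lemma bsim_rtrancl:
  assumes "bsim c d P P"
  shows "bsim (c\<^sup>*) (d\<^sup>*) P P"
  unfolding bsim_def
proof (intro allI impI, elim conjE)
  fix \<sigma> \<tau> \<tau>'
  assume "(\<sigma>, \<tau>) \<in> c\<^sup>*" and "(\<tau>, \<tau>') \<in> P"
  then show "\<exists>\<sigma>'. (\<sigma>, \<sigma>') \<in> P \<and> (\<sigma>', \<tau>') \<in> d\<^sup>*"
  proof (induction rule: converse_rtrancl_induct)
    case base
    then show ?case by blast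
  next
    \<comment> \<open>The induction hypothesis matches the run from \<open>\<sigma>\<close>; pulling
      its right start back through \<open>d\<close> prepends one step.\<close>
    case (step \<rho> \<sigma>)
    then show ?case
      using assms unfolding bsim_def by (meson converse_rtrancl_into_rtrancl)
  qed
qed

lemma bsim_while:
  assumes "bsim c c' (P \<inter> left_cond e \<inter> right_cond e') P"
  shows "bsim (while_rel e c) (while_rel e' c') P (P \<inter> - left_cond e \<inter> - right_cond e')"
  \<comment> \<open>The postcondition puts the final right state outside \<open>e'\<close>, so the
    matching run exits its loop there.\<close>
  using bsim_rtrancl [OF bsim_guarded [OF assms]]
  unfolding bsim_iff_relcomp while_rel_def left_cond_def right_cond_def by fast

lemma bsim_seq:
  assumes "bsim c c' P R" and "bsim d d' R Q"
  shows "bsim (c O d) (c' O d') P Q"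
  using assms unfolding bsim_iff_relcomp by fast

lemma bsim_assign_any:
  fixes R :: "('var, 'val) state rel"
  assumes "Id \<subseteq> right_embed (assign_any y) O bitest R O right_embed (assign_any y)"
  shows "bsim (assign_any x) (assign_any y) R UNIV"
  unfolding bsim_def
proof (intro allI impI)
  fix \<sigma> \<tau> \<tau>' :: "('var, 'val) state"
  have "((\<sigma>, \<tau>'), (\<sigma>, \<tau>')) \<in> right_embed (assign_any y) O bitest R O right_embed (assign_any y)"
    using assms by blast
  then show "\<exists>\<sigma>'. (\<sigma>, \<sigma>') \<in> R \<and> (\<sigma>', \<tau>') \<in> assign_any y"
    \<comment> \<open>The witness is the right component where \<open>bitest R\<close> holds;
      \<open>Id\<close> keeps the left one at \<open>\<sigma>\<close>.\<close>
    unfolding right_embed_def tensor_def bitest_def by blast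
qed

lemma bsim_conseq:
  assumes "R \<subseteq> P" and "bsim c d R S" and "Q \<subseteq> S"
  shows "bsim c d P Q"
  using assms unfolding bsim_iff_relcomp by blast

lemma bsim_disj:
  assumes "bsim c d P Q" and "bsim c d P R"
  shows "bsim c d P (Q \<union> R)"
  using assms unfolding bsim_iff_relcomp by blast

theorem theorem7p9:
  fixes P Q R S c c' d d' :: "('var, 'val) state rel"
    and e e' :: "('var, 'val) state set"
    and x y :: 'var
  shows
    "(bsim c c' (P \<inter> left_cond e \<inter> right_cond e') Q \<and>
      bsim d d' (P \<inter> - left_cond e \<inter> - right_cond e') Q
        \<longrightarrow> bsim (if_rel e c d) (if_rel e' c' d') P Q) \<and>
     (bsim c c' (P \<inter> left_cond e \<inter> right_cond e') P
        \<longrightarrow> bsim (while_rel e c) (while_rel e' c') P (P \<inter> - left_cond e \<inter> - right_cond e')) \<and>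
     (bsim c c' P R \<and> bsim d d' R Q
        \<longrightarrow> bsim (c O d) (c' O d') P Q) \<and>
     (Id \<subseteq> right_embed (assign_any y) O bitest R O right_embed (assign_any y)
        \<longrightarrow> bsim (assign_any x) (assign_any y) R UNIV) \<and>
     (R \<subseteq> P \<and> bsim c d R S \<and> Q \<subseteq> S
        \<longrightarrow> bsim c d P Q) \<and>
     (bsim c d P Q \<and> bsim c d P R
        \<longrightarrow> bsim c d P (Q \<union> R))"
  by (intro conjI impI; (elim conjE)?)
    (fact bsim_if bsim_while bsim_seq bsim_assign_any bsim_conseq bsim_disj)+

end
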